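(* Let $E_P\in\mathrm{GF}(2)^{m\times n}$ and $H_P^{\mathrm{sep}}\in\mathrm{GF}(2)^{h\times n}$ be binary matrices, let $\bm\ell\in\mathrm{GF}(2)^n$ be a row vector, and let $$M_P=\begin{bmatrix}E_P\\ H_P^{\mathrm{sep}}\end{bmatrix}\in\mathrm{GF}(2)^{(m+h)\times n}.$$ If there are no column vectors $\bm\alpha\in\mathrm{GF}(2)^m$, $\bm\gamma\in\mathrm{GF}(2)^h$ with $$\bm\alpha^{\top}E_P\oplus\bm\gamma^{\top}H_P^{\mathrm{sep}}=\bm\ell,$$ then there exists a binary row vector $\bm w\in\mathrm{GF}(2)^n$ such that $$M_P\bm w^{\top}=\bm 0,\qquad \bm\ell\,\bm w^{\top}=1 .$$ Conversely, the existence of such a vector $\bm w$ implies that $\bm\ell$ is not in the row space of $M_P$.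
   Context: All arithmetic is over $\mathrm{GF}(2)$, with $\oplus$ denoting addition. In the intended application $P\in\{X,Z\}$, the $n$ coordinates are the active data qubits of a lattice-surgery merge of two surface-code patches, the rows of $E_P$ are the supports of the available effective $P$-type seam operators, the rows of $H_P^{\mathrm{sep}}$ are the supports of the $P$-type stabilizer constraints of the separated (pre-merge) configuration, and $\bm\ell$ is the support of a representative of the target joint logical parity $P_L\otimes P_L$. *)

theory Defs
  imports "HOL-Library.Z2" "Jordan_Normal_Form.VS_Connect"
begin

end

(*
  This is the Fredholm alternative for a finite set S of vectors (the rows), by induction on S:
  either l lies in span S, or some w orthogonal to S separates it, that is l * w = 1.
  When r is added and w separates l from span S, then w still works if r * w = 0.
  Otherwise consider l' = l - r / (r * w). If l' lies in span S, then l lies in the span of S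
  and r. If u separates l' from span S, then correcting u along w to make it orthogonal to r
  separates l, because this changes the value on l by exactly l' * u - l * u.
*)
theory Submission
  imports Defs
begin

text \<open>Passes from the row-vector products of the theorem to the transpose form in which
  \<open>row_space_eq\<close> describes the row space. Commutativity enters because the factors of
  each scalar product change places.\<close>

lemma mat_of_row_mult:
  fixes A :: "'a :: comm_semiring_0 mat"
  assumes "y \<in> carrier_vec (dim_row A)"
  shows "mat_of_row y * A = mat_of_row (A\<^sup>T *\<^sub>v y)"
  using assms by (intro eq_matI) (auto simp: comm_scalar_prod[of y "dim_row A"])

context vec_space
begin

lemma span_mem_or_separated:
  assumes "finite S" "S \<subseteq> carrier_vec n" "l \<in> carrier_vec n"
  shows "l \<in> span S \<or> (\<exists>w \<in> carrier_vec n. (\<forall>r \<in> S. r \<bullet> w = 0) \<and> l \<bullet> w = 1)"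
  using assms
\<comment> \<open>\<open>l\<close> is generalized because the induction hypothesis is applied twice,
  to \<open>l\<close> and to a shift of \<open>l\<close> along \<open>r\<close>.\<close>
proof (induction arbitrary: l rule: finite_induct)
  case empty
  show ?case
  proof (cases "l = 0\<^sub>v n")
    case True
    then show ?thesis using span_zero by (simp add: module_vec_simps)
  next
    case False
    then obtain i where i: "i < n" "l $ i \<noteq> 0"
      using empty by (metis eq_vecI carrier_vecD index_zero_vec)
    \<comment> \<open>The empty set spans only zero, so any nonzero coordinate of \<open>l\<close>
      separates; the scaling makes its value 1.\<close>
    let ?w = "inverse (l $ i) \<cdot>\<^sub>v unit_vec n i"
    have "l \<bullet> ?w = 1" using i empty by (simp add: scalar_prod_right_unit)
    moreover have "?w \<in> carrier_vec n" by simp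
    ultimately show ?thesis by blast
  qed
next
  case (insert r S)
  have S: "S \<subseteq> carrier_vec n" and r: "r \<in> carrier_vec n"
    and l: "l \<in> carrier_vec n"
    using insert.prems by auto
  have mono: "span S \<subseteq> span (insert r S)" by (rule span_is_monotone) auto
  show ?case
  proof (cases "l \<in> span S")
    case True
    then show ?thesis using mono by blast
  next
    case False
    then obtain w where w: "w \<in> carrier_vec n" "\<forall>r\<in>S. r \<bullet> w = 0" "l \<bullet> w = 1"
      using insert.IH[OF S l] by blast
    show ?thesis
    proof (cases "r \<bullet> w = 0")
      case True
      then show ?thesis using w by blast
    next
      case rw: False
      define c where "c = inverse (r \<bullet> w)"
      \<comment> \<open>Among the shifts of \<open>l\<close> along \<open>r\<close>, this is the one
        orthogonal to \<open>w\<close>. Hence adding multiples of \<open>w\<close> to a vector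
        leaves its product with \<open>?l\<close> unchanged.\<close>
      let ?l = "l + (- c) \<cdot>\<^sub>v r"
      have l': "?l \<in> carrier_vec n" using l r by simp
      show ?thesis
      proof (cases "?l \<in> span S")
        case True
        have ins: "insert r S \<subseteq> carrier_vec n" using S r by simp
        have "r \<in> span (insert r S)" using span_mem[of "insert r S" r] ins by auto
        then have "c \<cdot>\<^sub>v r \<in> span (insert r S)" by (rule smult_in_span[OF ins])
        then have "?l + c \<cdot>\<^sub>v r \<in> span (insert r S)"
          using span_add1[of "insert r S" ?l "c \<cdot>\<^sub>v r"] ins mono True by (auto simp: module_vec_simps)
        moreover have "?l + c \<cdot>\<^sub>v r = l" using l r by (intro eq_vecI) auto
        ultimately show ?thesis by simp
      next
        case False
        then obtain u where u: "u \<in> carrier_vec n" "\<forall>r\<in>S. r \<bullet> u = 0" "?l \<bullet> u = 1"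
          using insert.IH[OF S l'] by blast
        let ?w = "u + (- (c * (r \<bullet> u))) \<cdot>\<^sub>v w"
        have dist: "v \<bullet> ?w = v \<bullet> u - c * (r \<bullet> u) * (v \<bullet> w)" if "v \<in> carrier_vec n" for v
          using that u(1) w(1) by (simp add: scalar_prod_add_distrib[of v n])
        have "r \<bullet> ?w = 0" unfolding dist[OF r] using rw by (simp add: c_def)
        moreover have "s \<bullet> ?w = 0" if "s \<in> S" for s
        proof -
          have "s \<in> carrier_vec n" using that S by blast
          then show ?thesis using that u(2) w(2) by (simp add: dist)
        qed
        moreover have "l \<bullet> ?w = 1"
          using u(3) w(3) u(1) l r by (simp add: dist[OF l] add_scalar_prod_distrib[of l n])
        moreover have "?w \<in> carrier_vec n" using u w by simp
        ultimately show ?thesis by blast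
      qed
    qed
  qed
qed

lemma row_space_mem_iff:
  assumes A: "A \<in> carrier_mat k n" and l: "l \<in> carrier_vec n"
  shows "l \<in> row_space A \<longleftrightarrow> (\<exists>y \<in> carrier_vec k. mat_of_row y * A = mat_of_row l)"
proof -
  have "mat_of_row y * A = mat_of_row l \<longleftrightarrow> A\<^sup>T *\<^sub>v y = l" if "y \<in> carrier_vec k" for y
    using that A mat_of_row_mult[of y A] by (metis carrier_matD(1) row_mat_of_row)
  then show ?thesis using A l by (auto simp: row_space_eq[OF A])
qed

text \<open>Forwards, the separation is applied to the finite set of rows of \<open>A\<close>;
  orthogonality to every row is the equation for \<open>A *\<^sub>v w\<close>. Backwards,
  \<open>l = A\<^sup>T *\<^sub>v y\<close> moves the product with \<open>w\<close> onto
  \<open>y \<bullet> (A *\<^sub>v w)\<close>, which vanishes.\<close>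

lemma notin_row_space_iff_separated:
  assumes A: "A \<in> carrier_mat k n" and l: "l \<in> carrier_vec n"
  shows "l \<notin> row_space A \<longleftrightarrow> (\<exists>w \<in> carrier_vec n. A *\<^sub>v w = 0\<^sub>v k \<and> l \<bullet> w = 1)"
proof
  have rows: "set (rows A) \<subseteq> carrier_vec n" using A rows_carrier[of A] by auto
  assume "l \<notin> row_space A"
  then obtain w where w: "w \<in> carrier_vec n" "\<forall>r \<in> set (rows A). r \<bullet> w = 0" "l \<bullet> w = 1"
    using span_mem_or_separated[OF _ rows l] by (auto simp: row_space_def)
  have "A *\<^sub>v w = 0\<^sub>v k"
    using w(2) A by (intro eq_vecI) (auto simp: rows_def)
  then show "\<exists>w \<in> carrier_vec n. A *\<^sub>v w = 0\<^sub>v k \<and> l \<bullet> w = 1" using w by blast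
next
  assume "\<exists>w \<in> carrier_vec n. A *\<^sub>v w = 0\<^sub>v k \<and> l \<bullet> w = 1"
  then obtain w where w: "w \<in> carrier_vec n" "A *\<^sub>v w = 0\<^sub>v k" "l \<bullet> w = 1" by blast
  show "l \<notin> row_space A"
  proof
    assume "l \<in> row_space A"
    then obtain y where y: "y \<in> carrier_vec k" "l = A\<^sup>T *\<^sub>v y"
      using A by (auto simp: row_space_eq[OF A])
    have "l \<bullet> w = y \<bullet> (A *\<^sub>v w)" using transpose_vec_mult_scalar[OF A w(1) y(1)] y(2) by simp
    then show False using w y by simp
  qed
qed

end

theorem proposition2:
  fixes E H :: "bit mat" and l :: "bit vec" and m h n :: nat
  assumes E: "E \<in> carrier_mat m n"
    and H: "H \<in> carrier_mat h n"
    and l: "l \<in> carrier_vec n"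
  shows "((\<nexists>\<alpha> \<gamma>. \<alpha> \<in> carrier_vec m \<and> \<gamma> \<in> carrier_vec h \<and>
              mat_of_row \<alpha> * E + mat_of_row \<gamma> * H = mat_of_row l) \<longrightarrow>
            (\<exists>w \<in> carrier_vec n. (E @\<^sub>r H) *\<^sub>v w = 0\<^sub>v (m + h) \<and> l \<bullet> w = 1)) \<and>
         ((\<exists>w \<in> carrier_vec n. (E @\<^sub>r H) *\<^sub>v w = 0\<^sub>v (m + h) \<and> l \<bullet> w = 1) \<longrightarrow>
            l \<notin> vec_space.row_space n (E @\<^sub>r H))"
proof -
  interpret vec_space "TYPE(bit)" n .
  have M: "E @\<^sub>r H \<in> carrier_mat (m + h) n" using E H by simp
  \<comment> \<open>The first implication assumes that no coefficients exist, while the separation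
    needs \<open>l\<close> outside the row space; this is the contrapositive of that
    passage.\<close>
  have "\<exists>\<alpha> \<gamma>. \<alpha> \<in> carrier_vec m \<and> \<gamma> \<in> carrier_vec h \<and>
      mat_of_row \<alpha> * E + mat_of_row \<gamma> * H = mat_of_row l" if lM: "l \<in> row_space (E @\<^sub>r H)"
  proof -
    obtain y where y: "y \<in> carrier_vec (m + h)" "mat_of_row y * (E @\<^sub>r H) = mat_of_row l"
      using lM row_space_mem_iff[OF M l] by blast
    \<comment> \<open>The coefficient vector is cut where the rows of \<open>E\<close> end and those
      of \<open>H\<close> begin.\<close>
    let ?\<alpha> = "vec_first y m" and ?\<gamma> = "vec_last y h"
    have "?\<alpha> \<in> carrier_vec m" "?\<gamma> \<in> carrier_vec h" by auto
    moreover have "?\<alpha> @\<^sub>v ?\<gamma> = y" using y(1) by simp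
    ultimately show ?thesis
      using y(2) mat_of_row_mult_append_rows[OF _ _ E H, of ?\<alpha> ?\<gamma>] by metis
  qed
  then show ?thesis using notin_row_space_iff_separated[OF M l] by blast
qed

end
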